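(* For all positive integers $n,m$, the $(n\times m)$-Rook's graph $G$ satisfies $\mathrm{tww}(G)\le 2(m-1)$.
   Context: The $(n\times m)$-Rook's graph has vertex set $\{1,\dots,n\}\times\{1,\dots,m\}$, with distinct vertices $(i,j),(i',j')$ adjacent iff $i=i'$ or $j=j'$ (equivalently, it is the Cartesian product $K_n\square K_m$ of complete graphs). Twin-width: a trigraph is a vertex set with two disjoint sets of edges, black and red. Contracting two distinct vertices $u,v$ replaces them by a new vertex $w$; each $x\ne u,v$ adjacent to exactly one of $u,v$ is joined to $w$ by a red edge; each $x$ adjacent to both is joined to $w$ by a black edge if $ux,vx$ are both black and by a red edge otherwise; other edges are unchanged. A simple graph is a trigraph with no red edges. A $d$-sequence for an $N$-vertex graph $G$ is a sequence $G=G_N,\dots,G_1$ of trigraphs, each obtained from the previous by one contraction, with every vertex of every $G_i$ incident to at most $d$ red edges; $\mathrm{tww}(G)$ is the least such $d$. *)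

theory Defs
  imports Main
begin

record 'a trigraph =
  verts :: "'a set"
  black :: "'a set set"
  red :: "'a set set"

definition is_trigraph :: "'a trigraph \<Rightarrow> bool" where
  "is_trigraph T \<longleftrightarrow>
     finite (verts T) \<and>
     (\<forall>e \<in> black T \<union> red T. e \<subseteq> verts T \<and> card e = 2) \<and>
     black T \<inter> red T = {}"

definition is_simple_graph :: "'a trigraph \<Rightarrow> bool" where
  "is_simple_graph G \<longleftrightarrow> is_trigraph G \<and> red G = {}"

definition adjacent :: "'a trigraph \<Rightarrow> 'a \<Rightarrow> 'a \<Rightarrow> bool" where
  "adjacent T x y \<longleftrightarrow> {x, y} \<in> black T \<union> red T"

definition contract :: "'a trigraph \<Rightarrow> 'a \<Rightarrow> 'a \<Rightarrow> 'a \<Rightarrow> 'a trigraph" where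
  "contract T u v w =
     \<lparr> verts = insert w (verts T - {u, v}),
       black = {e \<in> black T. u \<notin> e \<and> v \<notin> e}
         \<union> {{w, x} | x. x \<in> verts T - {u, v} \<and> {u, x} \<in> black T \<and> {v, x} \<in> black T},
       red = {e \<in> red T. u \<notin> e \<and> v \<notin> e}
         \<union> {{w, x} | x. x \<in> verts T - {u, v} \<and>
              (adjacent T u x \<noteq> adjacent T v x \<or>
               adjacent T u x \<and> adjacent T v x \<and> \<not> ({u, x} \<in> black T \<and> {v, x} \<in> black T))} \<rparr>"

text \<open>The new vertex only has to differ from the vertices that survive the contraction. It may
  reuse the name of one of the two contracted vertices, so that contractions are also possible
  over a finite vertex type.\<close>

definition contraction_step :: "'a trigraph \<Rightarrow> 'a trigraph \<Rightarrow> bool" where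
  "contraction_step T T' \<longleftrightarrow>
     (\<exists>u v w. u \<in> verts T \<and> v \<in> verts T \<and> u \<noteq> v \<and> w \<notin> verts T - {u, v} \<and> T' = contract T u v w)"

definition red_degree :: "'a trigraph \<Rightarrow> 'a \<Rightarrow> nat" where
  "red_degree T x = card {e \<in> red T. x \<in> e}"

definition d_sequence :: "nat \<Rightarrow> 'a trigraph \<Rightarrow> (nat \<Rightarrow> 'a trigraph) \<Rightarrow> bool" where
  "d_sequence d G S \<longleftrightarrow>
     S (card (verts G)) = G \<and>
     (\<forall>i \<in> {1..card (verts G)}. is_trigraph (S i)) \<and>
     (\<forall>i \<in> {1..<card (verts G)}. contraction_step (S (Suc i)) (S i)) \<and>
     (\<forall>i \<in> {1..card (verts G)}. \<forall>x \<in> verts (S i). red_degree (S i) x \<le> d)"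

definition tww :: "'a trigraph \<Rightarrow> nat" where
  "tww G = (LEAST d. \<exists>S. d_sequence d G S)"

definition rook_graph :: "nat \<Rightarrow> nat \<Rightarrow> (nat \<times> nat) trigraph" where
  "rook_graph n m =
     \<lparr> verts = {1..n} \<times> {1..m},
       black = {{(i, j), (i', j')} | i j i' j'.
          (i, j) \<in> {1..n} \<times> {1..m} \<and> (i', j') \<in> {1..n} \<times> {1..m} \<and>
          (i, j) \<noteq> (i', j') \<and> (i = i' \<or> j = j')},
       red = {} \<rparr>"

lemma is_simple_graph_rook_graph: "is_simple_graph (rook_graph n m)"
  by (auto simp: is_simple_graph_def is_trigraph_def rook_graph_def card_insert_if)

lemma is_trigraph_contract:
  assumes T: "is_trigraph T" and w: "w \<notin> verts T - {u, v}"
  shows "is_trigraph (contract T u v w)"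
proof -
  have e: "e \<subseteq> verts T" "card e = 2" if "e \<in> black T \<or> e \<in> red T" for e
    using T that by (auto simp: is_trigraph_def)
  have disj: "e \<notin> red T" if "e \<in> black T" for e
    using T that by (auto simp: is_trigraph_def)
  have new: "{w, x} \<notin> {e \<in> black T \<union> red T. u \<notin> e \<and> v \<notin> e}" for x
    using e(1)[of "{w, x}"] w by auto
  have wx: "x \<noteq> w" if "x \<in> verts T - {u, v}" for x
    using that w by auto
  have fin: "finite (verts (contract T u v w))"
    using T by (simp add: contract_def is_trigraph_def)
  have edges: "f \<subseteq> verts (contract T u v w) \<and> card f = 2"
    if "f \<in> black (contract T u v w) \<union> red (contract T u v w)" for f
  proof -
    from that consider "f \<in> black T \<or> f \<in> red T" "u \<notin> f" "v \<notin> f"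
      | x where "f = {w, x}" "x \<in> verts T - {u, v}"
      unfolding contract_def by auto
    then show ?thesis
    proof cases
      case 1
      then show ?thesis using e[of f] by (auto simp: contract_def)
    next
      case 2
      then show ?thesis using wx[of x] by (auto simp: contract_def)
    qed
  qed
  have "f \<notin> red (contract T u v w)" if f: "f \<in> black (contract T u v w)" for f
  proof
    assume r: "f \<in> red (contract T u v w)"
    show False
    proof (cases "w \<in> f \<and> (\<exists>x. f = {w, x})")
      case True
      then obtain x where fx: "f = {w, x}" by blast
      have b: "x' \<in> verts T - {u, v} \<Longrightarrow> {w, x} = {w, x'} \<Longrightarrow> x' = x" for x'
        using wx[of x'] by (auto simp: doubleton_eq_iff)
      from f new[of x] have "{u, x} \<in> black T \<and> {v, x} \<in> black T"
        unfolding fx contract_def using b by auto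
      moreover from r new[of x] have "\<not> ({u, x} \<in> black T \<and> {v, x} \<in> black T)"
        unfolding fx contract_def adjacent_def using b by auto
      ultimately show False by blast
    next
      case False
      then have "f \<in> black T" "f \<in> red T"
        using f r unfolding contract_def by auto
      then show False using disj by blast
    qed
  qed
  with fin edges show ?thesis
    unfolding is_trigraph_def by blast
qed

end

theory Submission
  imports Defs
begin

text \<open>
  The rows are merged one after the other into row 1, and within a row the vertices
  \<open>(k, 1), \<dots>, (k, m)\<close> are contracted in this order into \<open>(1, 1), \<dots>, (1, m)\<close>. Vertices of
  rows that have not been reached yet see \<open>(1, j)\<close> and \<open>(k, j)\<close> in the same way, so red edges
  occur only inside row 1 and between the already processed vertices \<open>(1, a)\<close>, \<open>a \<le> t\<close>, and the
  rest \<open>(k, b)\<close>, \<open>b > t\<close>, of the current row. Hence a vertex of row 1 has at most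
  \<open>(m - 1) + (m - t)\<close> red edges if \<open>1 \<le> t\<close> and at most \<open>m - 1\<close> if \<open>t = 0\<close>.
  When only row 1 is left, there are too few vertices to exceed the bound.
\<close>

section \<open>Contraction sequences as an inductive predicate\<close>

text \<open>Replaces the indexing of \<open>d_sequence\<close> by vertex counts, so that a sequence
  can be built by induction, from its last trigraph backwards.\<close>

inductive contractible :: "nat \<Rightarrow> 'a trigraph \<Rightarrow> bool" for d where
  single: "\<lbrakk>is_trigraph T; card (verts T) = 1; \<forall>x \<in> verts T. red_degree T x \<le> d\<rbrakk>
    \<Longrightarrow> contractible d T"
| step: "\<lbrakk>is_trigraph T; \<forall>x \<in> verts T. red_degree T x \<le> d; contraction_step T T';
    contractible d T'\<rbrakk> \<Longrightarrow> contractible d T"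

lemma card_verts_contraction_step:
  assumes "is_trigraph T" "contraction_step T T'"
  shows "card (verts T) = Suc (card (verts T'))" and "card (verts T') \<ge> 1"
proof -
  obtain u v w where *: "u \<in> verts T" "v \<in> verts T" "u \<noteq> v" "w \<notin> verts T - {u, v}"
    "T' = contract T u v w"
    using assms(2) by (auto simp: contraction_step_def)
  have fin: "finite (verts T)" using assms(1) by (simp add: is_trigraph_def)
  have "card {u, v} \<le> card (verts T)"
    using * fin by (intro card_mono) auto
  moreover have "card (verts T - {u, v}) = card (verts T) - card {u, v}"
    using * by (intro card_Diff_subset) auto
  moreover have "card (verts T') = Suc (card (verts T - {u, v}))"
    using * fin by (simp add: contract_def)
  ultimately show "card (verts T) = Suc (card (verts T'))" "card (verts T') \<ge> 1"
    using \<open>u \<noteq> v\<close> by auto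
qed

lemma d_sequence_if_contractible:
  assumes "contractible d T"
  shows "\<exists>S. d_sequence d T S"
  using assms
proof induction
  case (single T)
  then show ?case
    by (intro exI[of _ "\<lambda>_. T"]) (auto simp: d_sequence_def)
next
  case (step T T')
  then obtain S where S: "d_sequence d T' S" by blast
  have c: "card (verts T) = Suc (card (verts T'))"
    using card_verts_contraction_step step by blast
  \<comment> \<open>Indices are vertex counts, so \<open>T\<close> goes one place above the sequence
    of \<open>T'\<close> and nothing is reindexed.\<close>
  have "d_sequence d T (S(card (verts T) := T))"
    using S step c unfolding d_sequence_def by (auto simp: le_Suc_eq less_Suc_eq)
  then show ?case by blast
qed

lemma tww_le_if_contractible: "contractible d G \<Longrightarrow> tww G \<le> d"
  unfolding tww_def by (intro Least_le d_sequence_if_contractible)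

section \<open>Counting red neighbours\<close>

lemma red_edge_verts:
  assumes "is_trigraph T" "{x, y} \<in> red T"
  shows "x \<in> verts T" "y \<in> verts T"
proof -
  have "{x, y} \<subseteq> verts T" using assms unfolding is_trigraph_def by blast
  then show "x \<in> verts T" "y \<in> verts T" by auto
qed

text \<open>A red edge at \<open>x\<close> is determined by its other end, so any finite set
  containing all red neighbours bounds the degree.\<close>

lemma red_degree_le_card:
  assumes "is_trigraph T" "finite N" "\<And>y. \<lbrakk>y \<noteq> x; {x, y} \<in> red T\<rbrakk> \<Longrightarrow> y \<in> N"
  shows "red_degree T x \<le> card N"
proof -
  have "{e \<in> red T. x \<in> e} \<subseteq> (\<lambda>y. {x, y}) ` N"
  proof
    fix e assume e: "e \<in> {e \<in> red T. x \<in> e}"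
    then have "card e = 2" using assms(1) by (auto simp: is_trigraph_def)
    then obtain p q where "e = {p, q}" "p \<noteq> q" unfolding card_2_iff by blast
    moreover have "x = p \<or> x = q" using e \<open>e = {p, q}\<close> by auto
    ultimately obtain y where "y \<noteq> x" "e = {x, y}" by (metis insert_commute)
    then show "e \<in> (\<lambda>y. {x, y}) ` N" using e assms(3) by blast
  qed
  then have "card {e \<in> red T. x \<in> e} \<le> card ((\<lambda>y. {x, y}) ` N)"
    using assms(2) by (intro card_mono) auto
  also have "\<dots> \<le> card N" by (rule card_image_le[OF assms(2)])
  finally show ?thesis by (simp add: red_degree_def)
qed

text \<open>No vertex can have more than \<open>d\<close> neighbours here, so the contractions may
  be chosen arbitrarily. This settles the end of the sequence, when only row 1 is left.\<close>

lemma contractible_if_card_le: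
  assumes "is_trigraph T" "1 \<le> card (verts T)" "card (verts T) \<le> Suc d"
  shows "contractible d T"
  using assms
proof (induction "card (verts T)" arbitrary: T)
  case 0
  then show ?case by simp
next
  case (Suc c)
  have fin: "finite (verts T)" and sub: "\<And>e. e \<in> red T \<Longrightarrow> e \<subseteq> verts T"
    using Suc.prems(1) by (auto simp: is_trigraph_def)
  have deg: "red_degree T x \<le> d" if "x \<in> verts T" for x
  proof -
    have "red_degree T x \<le> card (verts T - {x})"
      using Suc.prems(1) fin sub by (intro red_degree_le_card) auto
    also have "\<dots> \<le> d" using that fin Suc.prems(3) by simp
    finally show ?thesis .
  qed
  show ?case
  proof (cases "c = 0")
    case True
    then show ?thesis using Suc.hyps Suc.prems deg by (auto intro: contractible.single)
  next
    case False
    then have "2 \<le> card (verts T)" using Suc.hyps(2) by simp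
    then obtain u v where uv: "u \<in> verts T" "v \<in> verts T" "u \<noteq> v"
      by (auto simp: numeral_2_eq_2 card_le_Suc_iff)
    have st: "contraction_step T (contract T u v u)"
      using uv by (auto simp: contraction_step_def)
    have "contractible d (contract T u v u)"
      using Suc card_verts_contraction_step[OF Suc.prems(1) st]
      by (intro Suc.hyps(1)) (auto intro!: is_trigraph_contract)
    then show ?thesis using st deg Suc.prems(1) by (auto intro: contractible.step)
  qed
qed

section \<open>The invariant for partially merged rows\<close>

text \<open>Rows \<open>2, \<dots>, k - 1\<close> and the first \<open>t\<close> vertices of row \<open>k\<close> have been merged into row 1.\<close>

definition rows_merged :: "nat \<Rightarrow> nat \<Rightarrow> nat \<Rightarrow> nat \<Rightarrow> (nat \<times> nat) trigraph \<Rightarrow> bool" where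
  "rows_merged n m k t T \<longleftrightarrow>
     is_trigraph T \<and>
     verts T = {(i, j). i \<in> {1..n} \<and> j \<in> {1..m} \<and> (i = 1 \<or> k < i \<or> i = k \<and> t < j)} \<and>
     (\<forall>i a i' b. {(i, a), (i', b)} \<in> red T \<longrightarrow>
        i = 1 \<and> i' = 1 \<or> i = 1 \<and> i' = k \<and> a \<le> t \<or> i = k \<and> i' = 1 \<and> b \<le> t) \<and>
     (\<forall>(i, a) \<in> verts T. \<forall>(i', b) \<in> verts T. k < i \<and> i \<noteq> i' \<longrightarrow>
        ({(i', b), (i, a)} \<in> black T \<longleftrightarrow> a = b))"

lemma black_rook_graph_iff:
  "{(i, a), (i', b)} \<in> black (rook_graph n m) \<longleftrightarrow>
     (i, a) \<in> {1..n} \<times> {1..m} \<and> (i', b) \<in> {1..n} \<times> {1..m} \<and> (i, a) \<noteq> (i', b) \<and> (i = i' \<or> a = b)"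
  (is "?L \<longleftrightarrow> ?R")
proof
  assume ?L
  then show ?R by (auto simp: rook_graph_def doubleton_eq_iff)
next
  assume ?R
  then show ?L unfolding rook_graph_def by simp blast
qed

lemma rows_merged_rook_graph: "rows_merged n m 2 0 (rook_graph n m)"
proof -
  have "verts (rook_graph n m) = {1..n} \<times> {1..m}" "red (rook_graph n m) = {}"
    by (simp_all add: rook_graph_def)
  then show ?thesis
    using is_simple_graph_rook_graph[of n m]
    unfolding rows_merged_def is_simple_graph_def by (auto simp: black_rook_graph_iff)
qed

lemma rows_mergedD:
  assumes "rows_merged n m k t T"
  shows "is_trigraph T"
    and "verts T = {(i, j). i \<in> {1..n} \<and> j \<in> {1..m} \<and> (i = 1 \<or> k < i \<or> i = k \<and> t < j)}"
    and "\<And>i a i' b. {(i, a), (i', b)} \<in> red T \<Longrightarrow>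
        i = 1 \<and> i' = 1 \<or> i = 1 \<and> i' = k \<and> a \<le> t \<or> i = k \<and> i' = 1 \<and> b \<le> t"
    and "\<And>i a i' b. \<lbrakk>(i, a) \<in> verts T; (i', b) \<in> verts T; k < i; i \<noteq> i'\<rbrakk> \<Longrightarrow>
        {(i', b), (i, a)} \<in> black T \<longleftrightarrow> a = b"
  using assms unfolding rows_merged_def by (simp, simp, simp, fast)

text \<open>At \<open>t = m\<close> row \<open>k\<close> has no vertices left, so of the red edges
  that the invariant permits only those inside row 1 can occur.\<close>

lemma rows_merged_next_row:
  assumes "rows_merged n m k m T"
  shows "rows_merged n m (Suc k) 0 T"
proof -
  note A = rows_mergedD[OF assms]
  have V: "verts T =
      {(i, j). i \<in> {1..n} \<and> j \<in> {1..m} \<and> (i = 1 \<or> Suc k < i \<or> i = Suc k \<and> 0 < j)}"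
    unfolding A(2) by auto
  have R: "i = 1 \<and> i' = 1" if e: "{(i, a), (i', b)} \<in> red T" for i a i' b
  proof -
    have "(i, a) \<in> verts T" "(i', b) \<in> verts T" using red_edge_verts[OF A(1) e] by auto
    then show ?thesis using A(3)[OF e] unfolding A(2) by auto
  qed
  have B: "{(i', b), (i, a)} \<in> black T \<longleftrightarrow> a = b"
    if "(i, a) \<in> verts T" "(i', b) \<in> verts T" "Suc k < i" "i \<noteq> i'" for i a i' b
    using A(4)[OF that(1,2)] that(3,4) by simp
  show ?thesis
    unfolding rows_merged_def using A(1) V R B by blast
qed

lemma red_degree_rows_merged:
  assumes T: "rows_merged n m k t T" and "2 \<le> k" "t \<le> m" "x \<in> verts T"
  shows "red_degree T x \<le> 2 * (m - 1)"
proof -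
  obtain i a where x: "x = (i, a)" by (cases x)
  note A = rows_mergedD[OF T]
  note tri = A(1)
  have ia: "i \<in> {1..n}" "a \<in> {1..m}" "i = 1 \<or> k < i \<or> i = k \<and> t < a"
    using assms(4) unfolding x A(2) by auto
  have nb: "i' \<in> {1..n} \<and> b \<in> {1..m} \<and> (i' = 1 \<or> k < i' \<or> i' = k \<and> t < b) \<and>
      (i = 1 \<and> i' = 1 \<or> i = 1 \<and> i' = k \<and> a \<le> t \<or> i = k \<and> i' = 1 \<and> b \<le> t)"
    if e: "{x, (i', b)} \<in> red T" for i' b
  proof -
    have "(i', b) \<in> verts T" using red_edge_verts[OF tri e] by simp
    then show ?thesis using A(3)[OF e[unfolded x]] unfolding A(2) by auto
  qed
  let ?R = "{1 :: nat} \<times> ({1..m} - {a})"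
  have cR: "card ?R = m - 1" using ia by (simp add: card_cartesian_product)
  \<comment> \<open>In row 1 only columns \<open>a \<le> t\<close> can have red edges into row
    \<open>k\<close>. Outside row 1 only row \<open>k\<close> can have red edges, and they lead to
    columns \<open>1..t\<close> of row 1.\<close>
  consider "i = 1" "a \<le> t" | "i = 1" "t < a" | "i \<noteq> 1" "t < m" | "i \<noteq> 1" "t = m"
    using \<open>t \<le> m\<close> by linarith
  then show ?thesis
  proof cases
    case 1
    have "red_degree T x \<le> card (?R \<union> {k} \<times> {t<..m})"
    proof (rule red_degree_le_card[OF tri])
      fix y assume y: "y \<noteq> x" "{x, y} \<in> red T"
      obtain i' b where y': "y = (i', b)" by (cases y)
      show "y \<in> ?R \<union> {k} \<times> {t<..m}" using nb[OF y(2)[unfolded y']] y(1) y' x ia \<open>2 \<le> k\<close> 1 by auto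
    qed simp
    also have "\<dots> \<le> (m - 1) + (m - t)"
      using card_Un_le[of ?R "{k} \<times> {t<..m}"] cR by (simp add: card_cartesian_product)
    \<comment> \<open>\<open>1 \<le> a \<le> t\<close> gives \<open>m - t \<le> m - 1\<close>; for
      \<open>t = 0\<close> this case is empty.\<close>
    also have "\<dots> \<le> 2 * (m - 1)" using 1 ia by auto
    finally show ?thesis .
  next
    case 2
    have "red_degree T x \<le> card ?R"
    proof (rule red_degree_le_card[OF tri])
      fix y assume y: "y \<noteq> x" "{x, y} \<in> red T"
      obtain i' b where y': "y = (i', b)" by (cases y)
      show "y \<in> ?R" using nb[OF y(2)[unfolded y']] y(1) y' x ia \<open>2 \<le> k\<close> 2 by auto
    qed simp
    then show ?thesis using cR by simp
  next
    case 3
    have "red_degree T x \<le> card ({1 :: nat} \<times> {1..t})"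
    proof (rule red_degree_le_card[OF tri])
      fix y assume y: "y \<noteq> x" "{x, y} \<in> red T"
      obtain i' b where y': "y = (i', b)" by (cases y)
      show "y \<in> {1} \<times> {1..t}" using nb[OF y(2)[unfolded y']] y(1) y' x ia \<open>2 \<le> k\<close> 3 by auto
    qed simp
    then show ?thesis using 3 by (simp add: card_cartesian_product)
  next
    case 4
    \<comment> \<open>Row \<open>k\<close> is exhausted, so \<open>x\<close> lies in a later row and
      has no red edge.\<close>
    have "red_degree T x \<le> card ({} :: (nat \<times> nat) set)"
    proof (rule red_degree_le_card[OF tri])
      fix y assume y: "y \<noteq> x" "{x, y} \<in> red T"
      obtain i' b where y': "y = (i', b)" by (cases y)
      show "y \<in> {}" using nb[OF y(2)[unfolded y']] y(1) y' x ia \<open>2 \<le> k\<close> 4 by auto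
    qed simp
    then show ?thesis by simp
  qed
qed

text \<open>The merged vertex keeps the name \<open>(1, Suc t)\<close>, so the vertices stay in the
  grid and the invariant applies again with \<open>t\<close> increased.\<close>

lemma rows_merged_contract:
  assumes T: "rows_merged n m k t T" and "2 \<le> k" "k \<le> n" "t < m"
  defines "T' \<equiv> contract T (1, Suc t) (k, Suc t) (1, Suc t)"
  shows "contraction_step T T'" and "rows_merged n m k (Suc t) T'"
proof -
  let ?u = "(1 :: nat, Suc t)" and ?v = "(k, Suc t)"
  note A = rows_mergedD[OF T]
  note tri = A(1) and V = A(2) and R = A(3) and B = A(4)
  have uv: "?u \<in> verts T" "?v \<in> verts T" "?u \<noteq> ?v" using assms(2-4) unfolding V by auto
  then show "contraction_step T T'" unfolding contraction_step_def T'_def by blast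
  have tri': "is_trigraph T'" unfolding T'_def by (rule is_trigraph_contract[OF tri]) simp
  have V': "verts T' = {(i, j). i \<in> {1..n} \<and> j \<in> {1..m} \<and> (i = 1 \<or> k < i \<or> i = k \<and> Suc t < j)}"
    using assms(2-4) unfolding T'_def contract_def V by auto
  \<comment> \<open>Rows after \<open>k\<close> cannot tell \<open>?u\<close> from
    \<open>?v\<close>: the black adjacencies agree and there are no red ones. So the contraction
    creates no red edge to them.\<close>
  have twins: "{?u, (i, a)} \<in> black T \<longleftrightarrow> a = Suc t" "{?v, (i, a)} \<in> black T \<longleftrightarrow> a = Suc t"
    "{?u, (i, a)} \<notin> red T" "{?v, (i, a)} \<notin> red T"
    if "(i, a) \<in> verts T" "k < i" for i a
    using B[OF that(1) uv(1) that(2)] B[OF that(1) uv(2) that(2)] that \<open>2 \<le> k\<close>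
      R[of 1 "Suc t" i a] R[of k "Suc t" i a] by auto
  have R': "i = 1 \<and> i' = 1 \<or> i = 1 \<and> i' = k \<and> a \<le> Suc t \<or> i = k \<and> i' = 1 \<and> b \<le> Suc t"
    if e: "{(i, a), (i', b)} \<in> red T'" for i a i' b
  proof -
    from e consider "{(i, a), (i', b)} \<in> red T"
      | c j where "{(i, a), (i', b)} = {?u, (c, j)}" "(c, j) \<in> verts T"
          "adjacent T ?u (c, j) \<noteq> adjacent T ?v (c, j) \<or> adjacent T ?u (c, j) \<and>
            adjacent T ?v (c, j) \<and> \<not> ({?u, (c, j)} \<in> black T \<and> {?v, (c, j)} \<in> black T)"
      unfolding T'_def contract_def by auto
    then show ?thesis
    proof cases
      case 1
      then show ?thesis using R[OF 1] by auto
    next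
      case 2
      have "\<not> k < c" using 2(3) twins[OF 2(2)] unfolding adjacent_def by auto
      then have "c = 1 \<or> c = k" using 2(2) by (auto simp: V)
      with 2(1) show ?thesis by (auto simp: doubleton_eq_iff)
    qed
  qed
  have B': "{(i', b), (i, a)} \<in> black T' \<longleftrightarrow> a = b"
    if "(i, a) \<in> verts T'" "(i', b) \<in> verts T'" "k < i" "i \<noteq> i'" for i a i' b
  proof -
    have mem: "(i, a) \<in> verts T" "(i', b) \<in> verts T" "(i', b) \<noteq> ?v" "(i, a) \<noteq> ?u" "(i, a) \<noteq> ?v"
      using that \<open>2 \<le> k\<close> by (auto simp: V V')
    show ?thesis
    proof (cases "(i', b) = ?u")
      case True
      \<comment> \<open>Old edges at \<open>?u\<close> are discarded, so only the rule for the
        merged vertex can produce this edge.\<close>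
      have "{(i', b), (i, a)} \<in> black T' \<longleftrightarrow> {?u, (i, a)} \<in> black T \<and> {?v, (i, a)} \<in> black T"
        using mem unfolding True T'_def contract_def by (auto simp: doubleton_eq_iff)
      then show ?thesis using twins mem(1) that(3) True by auto
    next
      case False
      then have "{(i', b), (i, a)} \<in> black T' \<longleftrightarrow> {(i', b), (i, a)} \<in> black T"
        using mem unfolding T'_def contract_def by (auto simp: doubleton_eq_iff)
      then show ?thesis using B mem that by auto
    qed
  qed
  show "rows_merged n m k (Suc t) T'"
    unfolding rows_merged_def using tri' V' R' B' by blast
qed

section \<open>Downward induction over columns and rows\<close>

text \<open>The induction descends from \<open>t = m\<close>, where \<open>next_row\<close> takes
  over; each step prepends one contraction.\<close>

lemma contractible_if_next_row_contractible:
  assumes "2 \<le> k" "k \<le> n"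
    and next_row: "\<And>T. rows_merged n m (Suc k) 0 T \<Longrightarrow> contractible (2 * (m - 1)) T"
    and "t \<le> m" "rows_merged n m k t T"
  shows "contractible (2 * (m - 1)) T"
  using assms(4,5)
proof (induction t arbitrary: T rule: inc_induct)
  case base
  then show ?case using next_row rows_merged_next_row by blast
next
  case (step t)
  note c = rows_merged_contract[OF step.prems assms(1,2) step.hyps(2)]
  show ?case
  proof (rule contractible.step[OF _ _ c(1) step.IH[OF c(2)]])
    show "is_trigraph T" using step.prems by (simp add: rows_merged_def)
    show "\<forall>x \<in> verts T. red_degree T x \<le> 2 * (m - 1)"
      using red_degree_rows_merged[OF step.prems] step.hyps assms(1) by simp
  qed
qed

lemma contractible_rows_merged:
  assumes "n \<ge> 1" "m \<ge> 1" "2 \<le> k" "k \<le> Suc n" "rows_merged n m k 0 T"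
  shows "contractible (2 * (m - 1)) T"
  using assms(4,3,5)
proof (induction k arbitrary: T rule: inc_induct)
  case base
  \<comment> \<open>For \<open>k = Suc n\<close> all rows from \<open>k\<close> on lie outside the
    grid. The \<open>m\<close> vertices left satisfy
    \<open>m \<le> Suc (2 * (m - 1))\<close>.\<close>
  then have "verts T = {1} \<times> {1..m}" and "is_trigraph T"
    using assms(1) by (auto simp: rows_merged_def)
  then show ?case
    using assms(2) by (intro contractible_if_card_le) (auto simp: card_cartesian_product)
next
  case (step k)
  then show ?case
    by (intro contractible_if_next_row_contractible[of k n m 0 T]) auto
qed

theorem theorem1p6:
  fixes n m :: nat
  assumes "n \<ge> 1" and "m \<ge> 1"
  shows "tww (rook_graph n m) \<le> 2 * (m - 1)"
proof (rule tww_le_if_contractible)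
  show "contractible (2 * (m - 1)) (rook_graph n m)"
    using assms by (intro contractible_rows_merged[OF _ _ _ _ rows_merged_rook_graph]) auto
qed

end
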